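(* Let $P_n$ be the path on $n\ge 2$ vertices. Then $\iota(\mathrm{Mid}(P_n))=\lfloor \frac{n+1}{3}\rfloor$.
   Context: For a graph $H$ and $S\subseteq V(H)$, let $N_H[S]$ be $S$ together with all vertices adjacent to a vertex of $S$. A set $S\subseteq V(H)$ is an isolating set of $H$ if $V(H)\setminus N_H[S]$ is an independent set of $H$; $\iota(H)$ is the minimum size of an isolating set of $H$. The middle graph $\mathrm{Mid}(G)$ has vertex set $V(G)\cup\{m_e: e\in E(G)\}$, with $v\sim m_e$ iff $v$ is an endpoint of $e$, $m_e\sim m_f$ iff distinct edges $e,f$ share an endpoint, and no edges between vertices of $V(G)$. *)

theory Defs
  imports Main
begin

text \<open>Undirected graphs; an edge is the two-element set of its endpoints.\<close>

record 'a ugraph =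
  verts :: "'a set"
  edges :: "'a set set"

definition finite_simple_graph :: "'a ugraph \<Rightarrow> bool" where
  "finite_simple_graph H \<longleftrightarrow>
     finite (verts H) \<and> (\<forall>e\<in>edges H. e \<subseteq> verts H \<and> card e = 2)"

definition adjacent :: "'a ugraph \<Rightarrow> 'a \<Rightarrow> 'a \<Rightarrow> bool" where
  "adjacent H u v \<longleftrightarrow> {u, v} \<in> edges H"

definition closed_neighborhood :: "'a ugraph \<Rightarrow> 'a set \<Rightarrow> 'a set" where
  "closed_neighborhood H S = S \<union> {v \<in> verts H. \<exists>u\<in>S. adjacent H u v}"

definition independent_set :: "'a ugraph \<Rightarrow> 'a set \<Rightarrow> bool" where
  "independent_set H I \<longleftrightarrow> I \<subseteq> verts H \<and> (\<forall>u\<in>I. \<forall>v\<in>I. \<not> adjacent H u v)"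

definition isolating_set :: "'a ugraph \<Rightarrow> 'a set \<Rightarrow> bool" where
  "isolating_set H S \<longleftrightarrow>
     S \<subseteq> verts H \<and> independent_set H (verts H - closed_neighborhood H S)"

text \<open>Meaningful for finite graphs only: an infinite set has \<open>card\<close> 0.\<close>

definition isolation_number :: "'a ugraph \<Rightarrow> nat" where
  "isolation_number H = Min {card S | S. isolating_set H S}"

datatype 'a mid_vertex = Orig 'a | Mid_Edge "'a set"

definition middle_graph :: "'a ugraph \<Rightarrow> 'a mid_vertex ugraph" where
  "middle_graph G =
     \<lparr>verts = Orig ` verts G \<union> Mid_Edge ` edges G,
      edges = {{Orig v, Mid_Edge e} | v e. v \<in> verts G \<and> e \<in> edges G \<and> v \<in> e} \<union>
              {{Mid_Edge e, Mid_Edge f} | e f.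
                 e \<in> edges G \<and> f \<in> edges G \<and> e \<noteq> f \<and> e \<inter> f \<noteq> {}}\<rparr>"

definition path_graph :: "nat \<Rightarrow> nat ugraph" where
  "path_graph n = \<lparr>verts = {0..<n}, edges = {{i, Suc i} | i. Suc i < n}\<rparr>"

lemma finite_simple_graph_path_graph: "finite_simple_graph (path_graph n)"
  by (auto simp: finite_simple_graph_def path_graph_def)

lemma finite_simple_graph_middle_graph:
  assumes "finite_simple_graph G"
  shows "finite_simple_graph (middle_graph G)"
proof -
  have "edges G \<subseteq> Pow (verts G)" and "finite (verts G)"
    using assms by (auto simp: finite_simple_graph_def)
  then have "finite (edges G)"
    by (meson finite_Pow_iff finite_subset)
  with \<open>finite (verts G)\<close> show ?thesis
    by (auto simp: finite_simple_graph_def middle_graph_def card_2_iff)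
qed

lemma isolation_number_attained:
  assumes "finite_simple_graph H"
  shows "\<exists>S. isolating_set H S \<and> card S = isolation_number H"
    and "isolating_set H S \<Longrightarrow> isolation_number H \<le> card S"
proof -
  have "{card S | S. isolating_set H S} \<subseteq> card ` Pow (verts H)"
    by (auto simp: isolating_set_def)
  moreover have "finite (verts H)"
    using assms by (simp add: finite_simple_graph_def)
  ultimately have fin: "finite {card S | S. isolating_set H S}"
    by (meson finite_Pow_iff finite_imageI finite_subset)
  have "isolating_set H (verts H)"
    by (auto simp: isolating_set_def independent_set_def closed_neighborhood_def)
  then have "{card S | S. isolating_set H S} \<noteq> {}"
    by blast
  from Min_in[OF fin this] show "\<exists>S. isolating_set H S \<and> card S = isolation_number H"
    by (auto simp: isolation_number_def)
  show "isolating_set H S \<Longrightarrow> isolation_number H \<le> card S"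
    unfolding isolation_number_def using fin by (intro Min_le) auto
qed

end

theory Submission
  imports Defs
begin

text \<open>An endpoint of \<open>e\<close> can only be dominated by vertices of the middle graph that also dominate
  \<open>m\<^sub>e\<close>, while the original vertices are pairwise nonadjacent. So a set is isolating iff it
  dominates every \<open>m\<^sub>e\<close>. For the path with edges \<open>m\<^sub>0, \<dots>, m\<^bsub>n-2\<^esub>\<close>, the closed
  neighbourhoods of \<open>m\<^sub>0, m\<^sub>3, m\<^sub>6, \<dots>\<close> are disjoint, which gives the lower bound; the vertices
  \<open>m\<^sub>1, m\<^sub>4, m\<^sub>7, \<dots>\<close> (the last one moved back to \<open>m\<^bsub>n-2\<^esub>\<close> if necessary) attain it.\<close>

lemma adjacent_middle_graph [simp]:
  "adjacent (middle_graph G) (Orig v) (Orig w) \<longleftrightarrow> False"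
  "adjacent (middle_graph G) (Orig v) (Mid_Edge e) \<longleftrightarrow> v \<in> verts G \<and> e \<in> edges G \<and> v \<in> e"
  "adjacent (middle_graph G) (Mid_Edge e) (Orig v) \<longleftrightarrow> v \<in> verts G \<and> e \<in> edges G \<and> v \<in> e"
  "adjacent (middle_graph G) (Mid_Edge e) (Mid_Edge f) \<longleftrightarrow>
     e \<in> edges G \<and> f \<in> edges G \<and> e \<noteq> f \<and> e \<inter> f \<noteq> {}"
  by (auto simp: adjacent_def middle_graph_def doubleton_eq_iff)

lemma verts_middle_graph: "verts (middle_graph G) = Orig ` verts G \<union> Mid_Edge ` edges G"
  by (simp add: middle_graph_def)

text \<open>The last disjunct admits \<open>f = e\<close>, harmless because
  \<open>Mid_Edge e\<close> dominates itself; this spares a side condition in the path case.\<close>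

lemma Mid_Edge_in_closed_neighborhood_iff:
  assumes "e \<in> edges G" and "e \<subseteq> verts G"
  shows "Mid_Edge e \<in> closed_neighborhood (middle_graph G) S \<longleftrightarrow>
    (\<exists>v\<in>e. Orig v \<in> S) \<or> Mid_Edge e \<in> S \<or> (\<exists>f\<in>edges G. Mid_Edge f \<in> S \<and> e \<inter> f \<noteq> {})"
    (is "?L \<longleftrightarrow> ?R")
proof
  assume ?L
  then consider "Mid_Edge e \<in> S" | u where "u \<in> S" "adjacent (middle_graph G) u (Mid_Edge e)"
    by (auto simp: closed_neighborhood_def)
  then show ?R
  proof cases
    case 2
    then show ?thesis by (cases u) auto
  qed simp
next
  assume ?R
  then consider "Mid_Edge e \<in> S" | v where "v \<in> e" "Orig v \<in> S"
    | f where "f \<in> edges G" "Mid_Edge f \<in> S" "e \<inter> f \<noteq> {}" "f \<noteq> e"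
    by blast
  then show ?L
  proof cases
    case 2
    then have "adjacent (middle_graph G) (Orig v) (Mid_Edge e)" using assms by auto
    with 2 assms(1) show ?thesis
      unfolding closed_neighborhood_def verts_middle_graph by blast
  next
    case 3
    then have "adjacent (middle_graph G) (Mid_Edge f) (Mid_Edge e)" using assms by auto
    with 3 assms(1) show ?thesis
      unfolding closed_neighborhood_def verts_middle_graph by blast
  qed (simp add: closed_neighborhood_def)
qed

lemma isolating_set_middle_graph_iff:
  assumes "finite_simple_graph G"
  shows "isolating_set (middle_graph G) S \<longleftrightarrow>
    S \<subseteq> verts (middle_graph G) \<and>
    (\<forall>e\<in>edges G. Mid_Edge e \<in> closed_neighborhood (middle_graph G) S)"
    (is "_ \<longleftrightarrow> ?V \<and> (\<forall>e\<in>_. _ \<in> ?N)")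
proof (intro iffI conjI ballI)
  assume iso: "isolating_set (middle_graph G) S"
  then show ?V by (simp add: isolating_set_def)
  fix e assume e: "e \<in> edges G"
  then have sub: "e \<subseteq> verts G" and "card e = 2"
    using assms by (auto simp: finite_simple_graph_def)
  then obtain v where v: "v \<in> e" by fastforce
  show "Mid_Edge e \<in> ?N"
  proof (rule ccontr)
    assume not_dom: "Mid_Edge e \<notin> ?N"
    \<comment> \<open>Two adjacent vertices cannot both be undominated, so \<open>Orig v\<close>
      must be dominated.\<close>
    have "adjacent (middle_graph G) (Orig v) (Mid_Edge e)" using e v sub by auto
    moreover have "Orig v \<in> verts (middle_graph G)" "Mid_Edge e \<in> verts (middle_graph G)"
      using e v sub by (auto simp: verts_middle_graph)
    ultimately have "Orig v \<in> ?N"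
      using iso not_dom unfolding isolating_set_def independent_set_def by blast
    \<comment> \<open>The dominator is \<open>Orig v\<close> or some \<open>Mid_Edge f\<close> with
      \<open>v \<in> f\<close>; in the latter case \<open>e\<close> and \<open>f\<close> meet in
      \<open>v\<close>.\<close>
    then consider "Orig v \<in> S" | u where "u \<in> S" "adjacent (middle_graph G) u (Orig v)"
      by (auto simp: closed_neighborhood_def)
    then show False
    proof cases
      case 1
      with v not_dom show ?thesis
        by (auto simp: Mid_Edge_in_closed_neighborhood_iff[OF e sub])
    next
      case 2
      with v not_dom show ?thesis
        by (cases u) (auto simp: Mid_Edge_in_closed_neighborhood_iff[OF e sub])
    qed
  qed
next
  assume *: "?V \<and> (\<forall>e\<in>edges G. Mid_Edge e \<in> ?N)"
  then have "verts (middle_graph G) - ?N \<subseteq> range Orig"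
    by (auto simp: verts_middle_graph)
  then have "independent_set (middle_graph G) (verts (middle_graph G) - ?N)"
    unfolding independent_set_def
    by (metis Diff_subset adjacent_middle_graph(1) imageE subsetD)
  with * show "isolating_set (middle_graph G) S" by (simp add: isolating_set_def)
qed

text \<open>The right-hand side is |i - j| \<le> 1, written without truncated subtraction.\<close>

lemma path_graph_edges_meet_iff: "{i, Suc i} \<inter> {j, Suc j} \<noteq> {} \<longleftrightarrow> i \<le> Suc j \<and> j \<le> Suc i"
  by auto

lemma isolating_set_middle_path_graph_iff:
  "isolating_set (middle_graph (path_graph n)) S \<longleftrightarrow>
    S \<subseteq> verts (middle_graph (path_graph n)) \<and>
    (\<forall>i. Suc i < n \<longrightarrow> Orig i \<in> S \<or> Orig (Suc i) \<in> S \<or>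
       (\<exists>j. Suc j < n \<and> Mid_Edge {j, Suc j} \<in> S \<and> i \<le> Suc j \<and> j \<le> Suc i))"
proof -
  have "Mid_Edge {i, Suc i} \<in> closed_neighborhood (middle_graph (path_graph n)) S \<longleftrightarrow>
      Orig i \<in> S \<or> Orig (Suc i) \<in> S \<or>
      (\<exists>j. Suc j < n \<and> Mid_Edge {j, Suc j} \<in> S \<and> i \<le> Suc j \<and> j \<le> Suc i)"
    if "Suc i < n" for i
  proof -
    have e: "{i, Suc i} \<in> edges (path_graph n)" and sub: "{i, Suc i} \<subseteq> verts (path_graph n)"
      using that by (auto simp: path_graph_def)
    have "(\<exists>f\<in>edges (path_graph n). Mid_Edge f \<in> S \<and> {i, Suc i} \<inter> f \<noteq> {}) \<longleftrightarrow>
        (\<exists>j. Suc j < n \<and> Mid_Edge {j, Suc j} \<in> S \<and> {i, Suc i} \<inter> {j, Suc j} \<noteq> {})"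
      unfolding path_graph_def by auto
    then show ?thesis
      unfolding Mid_Edge_in_closed_neighborhood_iff[OF e sub] path_graph_edges_meet_iff
      using that by auto
  qed
  moreover have "(\<forall>e\<in>edges (path_graph n). P e) \<longleftrightarrow> (\<forall>i. Suc i < n \<longrightarrow> P {i, Suc i})" for P
    by (auto simp: path_graph_def)
  ultimately show ?thesis
    unfolding isolating_set_middle_graph_iff[OF finite_simple_graph_path_graph] by simp
qed

text \<open>The fibre of \<open>path_block\<close> over \<open>k\<close> contains the closed neighbourhood of \<open>m\<^bsub>3k\<^esub>\<close>; note that
  the maximum of the edge \<open>{j, j + 1}\<close> is \<open>j + 1\<close>.\<close>

fun path_block :: "nat mid_vertex \<Rightarrow> nat" where
  "path_block (Orig i) = i div 3"
| "path_block (Mid_Edge e) = Max e div 3"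

lemma isolating_set_middle_path_graph_card_ge:
  assumes iso: "isolating_set (middle_graph (path_graph n)) S"
  shows "(n + 1) div 3 \<le> card S"
proof -
  have "finite_simple_graph (middle_graph (path_graph n))"
    by (intro finite_simple_graph_middle_graph finite_simple_graph_path_graph)
  \<comment> \<open>This rules out the default value 0 of \<open>card\<close> on infinite
    sets.\<close>
  then have fin: "finite S"
    using iso by (auto simp: isolating_set_def finite_simple_graph_def intro: finite_subset)
  have "{..<(n + 1) div 3} \<subseteq> path_block ` S"
  proof
    fix k assume "k \<in> {..<(n + 1) div 3}"
    \<comment> \<open>From 3k + 3 \<le> n + 1: the edge \<open>{3 * k, Suc (3 * k)}\<close> exists
      and must be dominated.\<close>
    then have "Suc (3 * k) < n" by auto
    with iso consider "Orig (3 * k) \<in> S" | "Orig (Suc (3 * k)) \<in> S"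
      | j where "Mid_Edge {j, Suc j} \<in> S" "3 * k \<le> Suc j" "j \<le> Suc (3 * k)"
      unfolding isolating_set_middle_path_graph_iff by blast
    then show "k \<in> path_block ` S"
    proof cases
      case 1
      then show ?thesis by (rule rev_image_eqI) simp
    next
      case 2
      then show ?thesis by (rule rev_image_eqI) simp
    next
      case 3
      \<comment> \<open>The maximum \<open>Suc j\<close> lies between 3k and 3k + 2, so its quotient
        by 3 is k.\<close>
      from 3(1) show ?thesis
        by (rule rev_image_eqI) (use 3(2,3) in simp)
    qed
  qed
  then have "card {..<(n + 1) div 3} \<le> card S"
    using fin by (rule surj_card_le[rotated])
  then show ?thesis by simp
qed

lemma ex_isolating_set_middle_path_graph:
  assumes "n \<ge> 2"
  shows "\<exists>S. isolating_set (middle_graph (path_graph n)) S \<and> card S \<le> (n + 1) div 3"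
proof (intro exI conjI)
  \<comment> \<open>The middle of the block of edges 3k, 3k + 1, 3k + 2, capped at the index n - 2
    of the last edge.\<close>
  define c where "c k = min (3 * k + 1) (n - 2)" for k
  let ?S = "(\<lambda>k. Mid_Edge {c k, Suc (c k)}) ` {..<(n + 1) div 3}"
  have c: "Suc (c k) < n" for k using assms by (simp add: c_def)
  show "isolating_set (middle_graph (path_graph n)) ?S"
    unfolding isolating_set_middle_path_graph_iff
  proof (intro conjI allI impI disjI2)
    show "?S \<subseteq> verts (middle_graph (path_graph n))"
      using c by (auto simp: verts_middle_graph path_graph_def)
    fix i assume i: "Suc i < n"
    \<comment> \<open>Holds since i + 3 \<le> n + 1.\<close>
    have "i div 3 < (n + 1) div 3" using i by linarith
    \<comment> \<open>The cap preserves both bounds: it only lowers \<open>c\<close>, and never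
      below \<open>i\<close>, as i \<le> n - 2.\<close>
    moreover have "i \<le> Suc (c (i div 3))" "c (i div 3) \<le> Suc i"
      using i by (auto simp: c_def)
    ultimately show "\<exists>j. Suc j < n \<and> Mid_Edge {j, Suc j} \<in> ?S \<and> i \<le> Suc j \<and> j \<le> Suc i"
      using c by blast
  qed
  show "card ?S \<le> (n + 1) div 3"
    using card_image_le[of "{..<(n + 1) div 3}"] by simp
qed

theorem theorem4:
  fixes n :: nat
  assumes "n \<ge> 2"
  shows "isolation_number (middle_graph (path_graph n)) = (n + 1) div 3"
proof -
  have "finite_simple_graph (middle_graph (path_graph n))"
    by (intro finite_simple_graph_middle_graph finite_simple_graph_path_graph)
  note attained = isolation_number_attained[OF this]
  show ?thesis
  proof (rule antisym)
    show "isolation_number (middle_graph (path_graph n)) \<le> (n + 1) div 3"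
      using ex_isolating_set_middle_path_graph[OF assms] attained(2) le_trans by blast
    show "(n + 1) div 3 \<le> isolation_number (middle_graph (path_graph n))"
      using attained(1) isolating_set_middle_path_graph_card_ge by metis
  qed
qed

end
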